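(* Let $\emptyset\ne S\subseteq L\subseteq M\subset N\subseteq V$. The table $\mathfrak{X}_{N}$ is strictly collapsible over $N\setminus M$ into the table $\mathfrak{X}_{M}$ with respect to the set $C_{S}=\{\lambda_{A}^{N}\mid S\subseteq A\subseteq L\}$ of MLL parameters (that is, with respect to every element of $C_S$) if and only if both $$\sum_{R\subseteq S}(-1)^{|S\setminus R|}\,\tilde d_{L_{R}}^{(M)}(x_{L_{R}})=0\qquad\text{for all }x_L\in\mathfrak{X}_L$$ and $$\sum_{Z\subseteq S}(-1)^{|S\setminus Z|}\,\nu_{N_{S}\cup Z}^{N}(x_{N_{S}},x_{Z})=\sum_{Z\subseteq S}(-1)^{|S\setminus Z|}\,\nu_{M_{S}\cup Z}^{N}(x_{M_{S}},x_{Z})\qquad\text{for all }x_N\in\mathfrak{X}_N,$$ where $L_R=L\setminus R$, $M_{S}=M\setminus S$ and $N_{S}=N\setminus S$.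
   Context: $V$ is a finite index set; for $v\in V$, $X_v$ is a categorical variable with finite level set $\mathfrak{X}_v=\{0,1,\dots,|\mathfrak{X}_v|-1\}$. For $A\subseteq V$, $\mathfrak{X}_A=\prod_{v\in A}\mathfrak{X}_v$ (with $|\mathfrak{X}_\emptyset|=1$); for $x\in\mathfrak{X}_A$ and $B\subseteq A$, $x_B$ is the restriction of $x$ to $B$. The joint distribution $p=p_V$ of $(X_v)_{v\in V}$ on $\mathfrak{X}_V$ is strictly positive, and $p_A$ denotes its marginal on $\mathfrak{X}_A$. The symbol $\subset$ denotes strict inclusion. For $L\subseteq M\subseteq V$ and $x_L\in\mathfrak{X}_L$, define $$\nu_L^M(x_L)=\frac{1}{|\mathfrak{X}_{M\setminus L}|}\sum_{j_M\in\mathfrak{X}_M:\,j_L=x_L}\log p_M(j_M),\qquad \lambda_L^M(x_L)=\sum_{L'\subseteq L}(-1)^{|L\setminus L'|}\nu_{L'}^M(x_{L'}).$$ $\lambda_L^M$ is called a marginal log-linear (MLL) parameter. For $\emptyset\ne A\subseteq M\subset N\subseteq V$, the table $\mathfrak{X}_N$ is strictly collapsible over $N\setminus M$ into $\mathfrak{X}_M$ with respect to $\lambda_A^N$ if (i) $\lambda_A^M(x_A)=\lambda_A^N(x_A)$ for all $x_A\in\mathfrak{X}_A$, and (ii) $\lambda_Z^N(x_Z)=0$ for all $x_Z\in\mathfrak{X}_Z$ and all $Z\subseteq N$ with $A\subset Z\not\subseteq M$. For $M\subset N$ define $d^{(M)}(x_M)=\log p_M(x_M)-\nu_M^N(x_M)$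 for $x_M\in\mathfrak{X}_M$, and for $Z\subseteq M$, $$\tilde d_Z^{(M)}(x_Z)=\frac{1}{|\mathfrak{X}_{M\setminus Z}|}\sum_{j_M\in\mathfrak{X}_M:\,j_Z=x_Z}d^{(M)}(j_M).$$ *)

theory Defs
  imports "HOL-Probability.Probability"
begin

text \<open>
  A cell of the table over \<open>A\<close> is an extensional function, where \<open>k v\<close> is the number of
  levels of \<open>X\<^sub>v\<close>. The cell \<open>x\<^sub>B\<close> is then \<open>restrict x B\<close>, and the table over the
  empty set has exactly one cell.
\<close>

definition table :: "('v \<Rightarrow> nat) \<Rightarrow> 'v set \<Rightarrow> ('v \<Rightarrow> nat) set" where
  "table k A = (\<Pi>\<^sub>E v\<in>A. {..<k v})"

definition marginal :: "('v \<Rightarrow> nat) pmf \<Rightarrow> 'v set \<Rightarrow> ('v \<Rightarrow> nat) pmf" where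
  "marginal p A = map_pmf (\<lambda>x. restrict x A) p"

text \<open>
  \<open>nu k p L M x\<close> is \<open>\<nu>\<^sub>L\<^sup>M(x)\<close>, and \<open>mll k p L M x\<close> is the marginal log-linear parameter
  \<open>\<lambda>\<^sub>L\<^sup>M(x)\<close>; the argument \<open>x\<close> is meant to be a cell of the table over \<open>L\<close>.
\<close>

definition nu :: "('v \<Rightarrow> nat) \<Rightarrow> ('v \<Rightarrow> nat) pmf \<Rightarrow> 'v set \<Rightarrow> 'v set \<Rightarrow> ('v \<Rightarrow> nat) \<Rightarrow> real" where
  "nu k p L M x =
     1 / real (card (table k (M - L))) *
     (\<Sum>j\<in>{j \<in> table k M. restrict j L = x}. ln (pmf (marginal p M) j))"

definition mll :: "('v \<Rightarrow> nat) \<Rightarrow> ('v \<Rightarrow> nat) pmf \<Rightarrow> 'v set \<Rightarrow> 'v set \<Rightarrow> ('v \<Rightarrow> nat) \<Rightarrow> real" where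
  "mll k p L M x = (\<Sum>L'\<in>Pow L. (-1) ^ card (L - L') * nu k p L' M (restrict x L'))"

text \<open>
  Strict collapsibility of the table over \<open>N\<close>, over \<open>N - M\<close> into the table over \<open>M\<close>, with
  respect to \<open>\<lambda>\<^sub>A\<^sup>N\<close>. It is meant for \<open>{} \<noteq> A \<subseteq> M \<subset> N\<close>.
\<close>

definition strictly_collapsible ::
    "('v \<Rightarrow> nat) \<Rightarrow> ('v \<Rightarrow> nat) pmf \<Rightarrow> 'v set \<Rightarrow> 'v set \<Rightarrow> 'v set \<Rightarrow> bool" where
  "strictly_collapsible k p N M A \<longleftrightarrow>
     (\<forall>x\<in>table k A. mll k p A M x = mll k p A N x) \<and>
     (\<forall>Z. Z \<subseteq> N \<and> A \<subset> Z \<and> \<not> Z \<subseteq> M \<longrightarrow> (\<forall>x\<in>table k Z. mll k p Z N x = 0))"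

text \<open>
  Both \<open>d\<^sup>(\<^sup>M\<^sup>)\<close> and its averages over the cells with a given \<open>Z\<close>-part depend on \<open>N\<close> as
  well, so \<open>N\<close> is an explicit argument.
\<close>

definition dM :: "('v \<Rightarrow> nat) \<Rightarrow> ('v \<Rightarrow> nat) pmf \<Rightarrow> 'v set \<Rightarrow> 'v set \<Rightarrow> ('v \<Rightarrow> nat) \<Rightarrow> real" where
  "dM k p M N x = ln (pmf (marginal p M) x) - nu k p M N x"

definition dM_avg ::
    "('v \<Rightarrow> nat) \<Rightarrow> ('v \<Rightarrow> nat) pmf \<Rightarrow> 'v set \<Rightarrow> 'v set \<Rightarrow> 'v set \<Rightarrow> ('v \<Rightarrow> nat) \<Rightarrow> real" where
  "dM_avg k p Z M N x =
     1 / real (card (table k (M - Z))) *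
     (\<Sum>j\<in>{j \<in> table k M. restrict j Z = x}. dM k p M N j)"

end

theory Submission imports Defs begin

text \<open>
  On the functions on the table over \<open>N\<close> let \<open>E\<^sub>A\<close> average out the coordinates outside \<open>A\<close>.
  As the coordinates of a uniformly distributed cell are independent,
  \<open>E\<^sub>A E\<^sub>B = E\<^bsub>A \<inter> B\<^esub>\<close>. Hence the alternating sums
  \<open>\<Lambda>\<^sub>A = \<Sum>J\<subseteq>A. (-1)\<^bsup>|A - J|\<^esup> E\<^sub>J\<close> are pairwise annihilating projections, the projections of the
  analysis of variance, and \<open>\<lambda>\<^sub>A\<^sup>N\<close> is \<open>\<Lambda>\<^sub>A\<close> applied to the logarithm of \<open>p\<^sub>N\<close>. A table over
  \<open>M \<subseteq> N\<close> needs no separate treatment: averaging a function on it agrees with averaging its lift to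
  the table over \<open>N\<close> (\<open>slice_average_eq_cond_avg\<close>).

  Each of the two equations of the theorem says that a sum of terms \<open>\<Lambda>\<^sub>A h\<close> vanishes. Indeed,
  \<open>\<Sum>Z\<subseteq>S. (-1)\<^bsup>|S - Z|\<^esup> E\<^bsub>(B - S) \<union> Z\<^esub>\<close> is the sum of the \<open>\<Lambda>\<^sub>A\<close> with \<open>S \<subseteq> A \<subseteq> B\<close>
  (\<open>contrast_eq_sum_effect\<close>). The first equation is, up to a sign, this with \<open>B = L\<close> and \<open>h\<close> the
  difference of the logarithms of \<open>p\<^sub>M\<close> and \<open>p\<^sub>N\<close>; the second is the difference of the cases
  \<open>B = N\<close> and \<open>B = M\<close>, which leaves the \<open>A\<close> with \<open>S \<subseteq> A \<subseteq> N\<close> not contained in \<open>M\<close>.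

  A sum of terms \<open>\<Lambda>\<^sub>A h\<close> over distinct \<open>A\<close> vanishes only if every term does, since applying \<open>\<Lambda>\<^sub>B\<close>
  extracts the term for \<open>B\<close> (\<open>sum_effect_zero_iff\<close>). So the equations say that
  \<open>\<lambda>\<^sub>A\<^sup>M = \<lambda>\<^sub>A\<^sup>N\<close> for \<open>S \<subseteq> A \<subseteq> L\<close> and that \<open>\<lambda>\<^sub>Z\<^sup>N = 0\<close> for all \<open>Z \<supseteq> S\<close> not
  contained in \<open>M\<close>, which is strict collapsibility with respect to all \<open>A\<close> between \<open>S\<close> and \<open>L\<close>.
\<close>

section \<open>Alternating sums over subsets\<close>

text \<open>
  The two subsets \<open>L\<close> and \<open>insert v L\<close> contribute opposite terms.
\<close>

lemma alternating_sum_eq_zero: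
  fixes c :: "'a set \<Rightarrow> real"
  assumes "finite A" "v \<in> A" "\<And>L. L \<subseteq> A - {v} \<Longrightarrow> c (insert v L) = c L"
  shows "(\<Sum>L\<in>Pow A. (-1) ^ card (A - L) * c L) = 0"
proof -
  let ?B = "A - {v}"
  have A: "A = insert v ?B" using assms(2) by auto
  have fin: "finite ?B" using assms(1) by simp
  have inj: "inj_on (insert v) (Pow ?B)" by (auto simp: inj_on_def)
  have "(\<Sum>L\<in>Pow A. (-1) ^ card (A - L) * c L) =
      (\<Sum>L\<in>Pow ?B. (-1) ^ card (A - L) * c L) +
      (\<Sum>L\<in>insert v ` Pow ?B. (-1) ^ card (A - L) * c L)"
    by (subst A, subst Pow_insert, rule sum.union_disjoint) (use fin in \<open>auto simp: A[symmetric]\<close>)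
  also have "(\<Sum>L\<in>insert v ` Pow ?B. (-1) ^ card (A - L) * c L) =
      (\<Sum>L\<in>Pow ?B. (-1) ^ card (A - insert v L) * c (insert v L))"
    by (subst sum.reindex[OF inj]) simp
  also have "\<dots> = (\<Sum>L\<in>Pow ?B. - ((-1) ^ card (A - L) * c L))"
  proof (rule sum.cong[OF refl])
    fix L assume L: "L \<in> Pow ?B"
    then have "A - L = insert v (A - insert v L)" using assms(2) by auto
    then have "card (A - L) = Suc (card (A - insert v L))"
      using assms(1) by (metis card_insert_disjoint finite_Diff Diff_iff insertI1)
    then show "(-1) ^ card (A - insert v L) * c (insert v L) = - ((-1) ^ card (A - L) * c L)"
      using assms(3) L by simp
  qed
  finally show ?thesis by (simp add: sum_negf)
qed

lemma alternating_sum_interval: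
  assumes "finite B" "C \<subseteq> B"
  shows "(\<Sum>A | C \<subseteq> A \<and> A \<subseteq> B. (-1) ^ card (B - A)) = (if C = B then 1 else 0 :: real)"
proof (cases "C = B")
  case True
  then have "{A. C \<subseteq> A \<and> A \<subseteq> B} = {B}" by auto
  then show ?thesis using True by simp
next
  case False
  then obtain v where v: "v \<in> B" "v \<notin> C" using assms(2) by auto
  have "(\<Sum>A | C \<subseteq> A \<and> A \<subseteq> B. (-1) ^ card (B - A)) =
      (\<Sum>A\<in>Pow B. (-1) ^ card (B - A) * (if C \<subseteq> A then 1 else 0 :: real))"
    by (rule sum.mono_neutral_cong_left) (use assms in auto)
  also have "\<dots> = 0"
    by (rule alternating_sum_eq_zero[OF assms(1) v(1)]) (use v in auto)
  finally show ?thesis using False by simp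
qed

section \<open>Averages over slices of a table\<close>

text \<open>
  This is \<open>E\<^sub>A f\<close>. Averaging over all of the table, with the \<open>A\<close>-part of the cell overwritten
  by that of \<open>x\<close>, keeps the same normalisation for all \<open>A\<close>.
\<close>

definition cond_avg :: "('v \<Rightarrow> nat) \<Rightarrow> 'v set \<Rightarrow> 'v set \<Rightarrow> (('v \<Rightarrow> nat) \<Rightarrow> real) \<Rightarrow> ('v \<Rightarrow> nat) \<Rightarrow> real" where
  "cond_avg k N A f x = (\<Sum>y\<in>table k N. f (override_on y x A)) / real (card (table k N))"

text \<open>
  The projection \<open>\<Lambda>\<^sub>A\<close>: the interaction of exactly the coordinates in \<open>A\<close>.
\<close>

definition effect :: "('v \<Rightarrow> nat) \<Rightarrow> 'v set \<Rightarrow> 'v set \<Rightarrow> (('v \<Rightarrow> nat) \<Rightarrow> real) \<Rightarrow> ('v \<Rightarrow> nat) \<Rightarrow> real" where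
  "effect k N A f x = (\<Sum>J\<in>Pow A. (-1) ^ card (A - J) * cond_avg k N J f x)"

lemma restrict_in_table: "x \<in> table k N \<Longrightarrow> A \<subseteq> N \<Longrightarrow> restrict x A \<in> table k A"
  by (auto simp: table_def)

lemma override_in_table:
  "x \<in> table k N \<Longrightarrow> y \<in> table k N \<Longrightarrow> override_on y x A \<in> table k N"
  by (auto simp: table_def PiE_def Pi_def extensional_def override_on_def)

lemma finite_table: "finite A \<Longrightarrow> finite (table k A)"
  by (simp add: table_def finite_PiE)

lemma table_nonempty_iff: "table k A \<noteq> {} \<longleftrightarrow> (\<forall>v\<in>A. 0 < k v)"
  by (auto simp: table_def PiE_eq_empty_iff)

lemma ball_table_iff_ball_restrict:
  assumes "table k N \<noteq> {}" "A \<subseteq> N"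
  shows "(\<forall>x\<in>table k A. P x) \<longleftrightarrow> (\<forall>x\<in>table k N. P (restrict x A))"
proof
  assume R: "\<forall>x\<in>table k N. P (restrict x A)"
  show "\<forall>x\<in>table k A. P x"
  proof
    fix x assume x: "x \<in> table k A"
    from assms(1) obtain y where y: "y \<in> table k N" by auto
    have "override_on y x A \<in> table k N"
      using x y assms(2) by (auto simp: table_def PiE_def Pi_def extensional_def override_on_def)
    moreover have "restrict (override_on y x A) A = x"
      using x by (auto simp: table_def PiE_def extensional_def fun_eq_iff)
    ultimately show "P x" using R by metis
  qed
qed (use assms(2) restrict_in_table in blast)

lemma sum_table_restrict:
  fixes h :: "('v \<Rightarrow> nat) \<Rightarrow> real"
  assumes "B \<subseteq> N"
  shows "(\<Sum>y\<in>table k N. h (restrict y B)) =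
    real (card (table k (N - B))) * (\<Sum>u\<in>table k B. h u)"
proof -
  have "(\<Sum>y\<in>table k N. h (restrict y B)) = (\<Sum>(u, w)\<in>table k B \<times> table k (N - B). h u)"
    by (rule sum.reindex_bij_witness[where j = "\<lambda>y. (restrict y B, restrict y (N - B))"
          and i = "\<lambda>(u, w). override_on w u B"])
      (use assms in \<open>auto simp: table_def PiE_def Pi_def extensional_def override_on_def fun_eq_iff\<close>)
  also have "\<dots> = (\<Sum>u\<in>table k B. \<Sum>w\<in>table k (N - B). h u)"
    by (rule sum.cartesian_product[symmetric])
  finally show ?thesis by (simp add: sum_distrib_left)
qed

lemma card_table_split:
  assumes "B \<subseteq> N"
  shows "real (card (table k N)) = real (card (table k (N - B))) * real (card (table k B))"
  using sum_table_restrict[OF assms, of "\<lambda>_. 1" k] by simp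

text \<open>
  The slice of the table over \<open>M\<close> with \<open>A\<close>-part \<open>x\<^sub>A\<close> is a copy of the table over \<open>M - A\<close>, and a
  uniform cell of the table over \<open>N\<close> has a uniform \<open>M - A\<close>-part.
\<close>

lemma slice_average_eq_cond_avg:
  assumes "finite N" "table k N \<noteq> {}" "A \<subseteq> M" "M \<subseteq> N" "x \<in> table k N"
  shows "1 / real (card (table k (M - A))) *
      (\<Sum>j\<in>{j \<in> table k M. restrict j A = restrict x A}. g j) =
    cond_avg k N A (\<lambda>y. g (restrict y M)) x"
proof -
  let ?c = "real (card (table k (N - (M - A))))"
  have sub: "M - A \<subseteq> N" using assms by auto
  have pos: "real (card (table k D)) \<noteq> 0" if "D \<subseteq> N" for D
  proof -
    have "table k D \<noteq> {}" using that assms(2) unfolding table_nonempty_iff by blast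
    then show ?thesis using finite_table[OF finite_subset[OF that assms(1)], of k] by simp
  qed
  have ov: "restrict (override_on y x A) M = override_on (restrict y (M - A)) x A" for y
    using assms(3) by (auto simp: fun_eq_iff override_on_def)
  have slice: "(\<Sum>u\<in>table k (M - A). g (override_on u x A)) =
      (\<Sum>j\<in>{j \<in> table k M. restrict j A = restrict x A}. g j)"
  proof (rule sum.reindex_bij_witness[where i = "\<lambda>j. restrict j (M - A)"
        and j = "\<lambda>u. override_on u x A"])
    fix u assume u: "u \<in> table k (M - A)"
    show "override_on u x A \<in> {j \<in> table k M. restrict j A = restrict x A}"
      using u assms(3-5)
      by (auto simp: table_def PiE_def Pi_def extensional_def override_on_def fun_eq_iff)
    show "restrict (override_on u x A) (M - A) = u"
      using u by (auto simp: table_def PiE_def extensional_def override_on_def fun_eq_iff)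
  next
    fix j assume j: "j \<in> {j \<in> table k M. restrict j A = restrict x A}"
    then have eq: "j a = x a" if "a \<in> A" for a
      using that by (metis (mono_tags, lifting) mem_Collect_eq restrict_apply')
    show "override_on (restrict j (M - A)) x A = j"
      using j assms(3) eq by (auto simp: table_def PiE_def extensional_def override_on_def fun_eq_iff)
    show "restrict j (M - A) \<in> table k (M - A)"
      using j by (auto intro: restrict_in_table)
  qed simp
  have "(\<Sum>y\<in>table k N. g (restrict (override_on y x A) M)) =
      ?c * (\<Sum>j\<in>{j \<in> table k M. restrict j A = restrict x A}. g j)"
    unfolding ov slice[symmetric] by (rule sum_table_restrict[OF sub])
  then show ?thesis
    using pos[of "N - (M - A)"] by (simp add: cond_avg_def card_table_split[OF sub])
qed

lemma cond_avg_cong: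
  assumes "x \<in> table k N" "\<And>y. y \<in> table k N \<Longrightarrow> f y = g y"
  shows "cond_avg k N A f x = cond_avg k N A g x"
  unfolding cond_avg_def using assms by (simp add: override_in_table cong: sum.cong)

lemma cond_avg_diff: "cond_avg k N A (\<lambda>y. f y - g y) x = cond_avg k N A f x - cond_avg k N A g x"
  by (simp add: cond_avg_def sum_subtractf diff_divide_distrib)

lemma cond_avg_sum:
  "cond_avg k N A (\<lambda>y. \<Sum>i\<in>I. c i * f i y) x = (\<Sum>i\<in>I. c i * cond_avg k N A (f i) x)"
  unfolding cond_avg_def
  by (subst sum.swap) (simp add: sum_distrib_left sum_divide_distrib)

text \<open>
  Exchanging the \<open>A\<close>-parts of two cells is an involution on pairs of cells. After it, only the second
  cell of the pair enters the double average on the left-hand side.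
\<close>

lemma cond_avg_cond_avg:
  assumes "finite N" "table k N \<noteq> {}"
  shows "cond_avg k N B (cond_avg k N A f) x = cond_avg k N (A \<inter> B) f x"
proof -
  let ?T = "table k N"
  have "(\<Sum>y\<in>?T. \<Sum>z\<in>?T. f (override_on z (override_on y x B) A)) =
      (\<Sum>(y, z)\<in>?T \<times> ?T. f (override_on z (override_on y x B) A))"
    by (simp add: sum.cartesian_product)
  also have "\<dots> = (\<Sum>(y, z)\<in>?T \<times> ?T. f (override_on z x (A \<inter> B)))"
  proof (rule sum.reindex_bij_witness[where i = "\<lambda>(y, z). (override_on y z A, override_on z y A)"
        and j = "\<lambda>(y, z). (override_on y z A, override_on z y A)"])
    fix q assume "q \<in> ?T \<times> ?T"
    then obtain y z where q: "q = (y, z)" "y \<in> ?T" "z \<in> ?T" by auto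
    have "override_on (override_on z y A) x (A \<inter> B) = override_on z (override_on y x B) A"
      by (auto simp: override_on_def fun_eq_iff)
    then show "(case (case q of (y, z) \<Rightarrow> (override_on y z A, override_on z y A)) of
          (y, z) \<Rightarrow> f (override_on z x (A \<inter> B))) =
        (case q of (y, z) \<Rightarrow> f (override_on z (override_on y x B) A))"
      by (simp add: q)
  qed (auto intro!: override_in_table, auto simp: override_on_def fun_eq_iff)
  also have "\<dots> = real (card ?T) * (\<Sum>z\<in>?T. f (override_on z x (A \<inter> B)))"
    by (simp add: sum.cartesian_product[symmetric])
  finally show ?thesis
    using assms finite_table[OF assms(1), of k] by (simp add: cond_avg_def sum_divide_distrib[symmetric])
qed

section \<open>Interaction effects as projections\<close>

lemma effect_diff: "effect k N A (\<lambda>y. f y - g y) x = effect k N A f x - effect k N A g x"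
  by (simp add: effect_def cond_avg_diff right_diff_distrib sum_subtractf)

text \<open>
  If \<open>v \<in> A - B\<close>, then the term of \<open>J\<close> becomes the average for \<open>J \<inter> B\<close>, which is the same for
  \<open>J\<close> and \<open>insert v J\<close>. If \<open>A \<subseteq> B\<close>, then every \<open>J \<inter> B\<close> is \<open>J\<close>.
\<close>

lemma cond_avg_effect:
  assumes "finite N" "table k N \<noteq> {}" "A \<subseteq> N"
  shows "cond_avg k N B (effect k N A f) x = (if A \<subseteq> B then effect k N A f x else 0)"
proof -
  have fin: "finite A" using assms finite_subset by auto
  have *: "cond_avg k N B (effect k N A f) x =
      (\<Sum>J\<in>Pow A. (-1) ^ card (A - J) * cond_avg k N (J \<inter> B) f x)"
    unfolding effect_def cond_avg_sum cond_avg_cond_avg[OF assms(1,2)] ..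
  show ?thesis
  proof (cases "A \<subseteq> B")
    case True
    then have "J \<inter> B = J" if "J \<in> Pow A" for J using that by auto
    then show ?thesis using True * by (simp add: effect_def)
  next
    case False
    then obtain v where v: "v \<in> A" "v \<notin> B" by auto
    then show ?thesis
      unfolding * using False by (simp add: alternating_sum_eq_zero[OF fin v(1)])
  qed
qed

lemma effect_effect:
  assumes "finite N" "table k N \<noteq> {}" "A \<subseteq> N" "B \<subseteq> N"
  shows "effect k N B (effect k N A f) x = (if A = B then effect k N A f x else 0)"
proof (cases "A \<subseteq> B")
  case True
  have fin: "finite B" using assms finite_subset by auto
  have "effect k N B (effect k N A f) x =
      (\<Sum>J\<in>Pow B. (-1) ^ card (B - J) * (if A \<subseteq> J then effect k N A f x else 0))"
    by (simp add: effect_def[of k N B] cond_avg_effect[OF assms(1-3)])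
  also have "\<dots> = (\<Sum>J | A \<subseteq> J \<and> J \<subseteq> B. (-1) ^ card (B - J) * effect k N A f x)"
    by (rule sum.mono_neutral_cong_right) (use fin in auto)
  also have "\<dots> = (if A = B then 1 else 0) * effect k N A f x"
    using alternating_sum_interval[OF fin True] by (simp add: sum_distrib_right[symmetric])
  finally show ?thesis by simp
next
  case False
  then have "\<not> A \<subseteq> J" if "J \<in> Pow B" for J using that by auto
  then show ?thesis
    using False by (auto simp: effect_def[of k N B] cond_avg_effect[OF assms(1-3)])
qed

text \<open>
  Applying the effect of \<open>B\<close> to the vanishing sum leaves only the term of \<open>B\<close>.
\<close>

lemma sum_effect_zero_iff:
  assumes "finite N" "table k N \<noteq> {}" "\<A> \<subseteq> Pow N"
  shows "(\<forall>x\<in>table k N. (\<Sum>A\<in>\<A>. effect k N A f x) = 0) \<longleftrightarrow>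
    (\<forall>A\<in>\<A>. \<forall>x\<in>table k N. effect k N A f x = 0)"
proof (intro iffI ballI)
  fix B x
  assume sum0: "\<forall>x\<in>table k N. (\<Sum>A\<in>\<A>. effect k N A f x) = 0"
    and B: "B \<in> \<A>" and x: "x \<in> table k N"
  have fin: "finite \<A>" using assms finite_subset by blast
  let ?F = "\<lambda>y. \<Sum>A\<in>\<A>. 1 * effect k N A f y"
  have "effect k N B ?F x = (\<Sum>A\<in>\<A>. effect k N B (effect k N A f) x)"
    unfolding effect_def[of k N B] cond_avg_sum sum_distrib_left
    by (subst sum.swap) simp
  also have "\<dots> = (\<Sum>A\<in>\<A>. if A = B then effect k N A f x else 0)"
    using assms B by (intro sum.cong refl effect_effect) auto
  also have "\<dots> = effect k N B f x" using fin B by simp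
  finally have "effect k N B f x = effect k N B ?F x" ..
  also have "\<dots> = effect k N B (\<lambda>_. 0) x"
    using sum0 cond_avg_cong[OF x, of ?F "\<lambda>_. 0"] by (simp add: effect_def[of k N B])
  also have "\<dots> = 0" by (simp add: effect_def cond_avg_def)
  finally show "effect k N B f x = 0" .
qed simp

text \<open>
  In the double sum over \<open>J \<subseteq> A\<close> and \<open>S \<subseteq> A \<subseteq> B\<close>, the average for \<open>J\<close> has the coefficient
  \<open>\<Sum>A. (-1)\<^bsup>|A - J|\<^esup>\<close> over the \<open>A\<close> between \<open>S \<union> J\<close> and \<open>B\<close>. It vanishes unless
  \<open>S \<union> J = B\<close>, which means that \<open>J = (B - S) \<union> Z\<close> with \<open>Z \<subseteq> S\<close>.
\<close>

lemma contrast_eq_sum_effect: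
  assumes "finite B" "S \<subseteq> B"
  shows "(\<Sum>Z\<in>Pow S. (-1) ^ card (S - Z) * cond_avg k N ((B - S) \<union> Z) f x) =
    (\<Sum>A | S \<subseteq> A \<and> A \<subseteq> B. effect k N A f x)"
proof -
  let ?e = "\<lambda>J. cond_avg k N J f x"
  have fin: "finite {A. S \<subseteq> A \<and> A \<subseteq> B}" using assms(1) by simp
  have "(\<Sum>A | S \<subseteq> A \<and> A \<subseteq> B. effect k N A f x) =
      (\<Sum>A | S \<subseteq> A \<and> A \<subseteq> B. \<Sum>J | J \<in> Pow B \<and> J \<subseteq> A. (-1) ^ card (A - J) * ?e J)"
    unfolding effect_def by (intro sum.cong refl) auto
  also have "\<dots> = (\<Sum>J\<in>Pow B. \<Sum>A | A \<in> {A. S \<subseteq> A \<and> A \<subseteq> B} \<and> J \<subseteq> A. (-1) ^ card (A - J) * ?e J)"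
    by (rule sum.swap_restrict) (use assms fin in auto)
  also have "\<dots> = (\<Sum>J\<in>Pow B. if S \<union> J = B then (-1) ^ card (B - J) * ?e J else 0)"
  proof (rule sum.cong[OF refl])
    fix J assume J: "J \<in> Pow B"
    have sgn: "(-1) ^ card (A - J) = (-1) ^ card (B - J) * ((-1) ^ card (B - A) :: real)"
      if "J \<subseteq> A" "A \<subseteq> B" for A
    proof -
      have "B - J = (B - A) \<union> (A - J)" using that by auto
      moreover have "card ((B - A) \<union> (A - J)) = card (B - A) + card (A - J)"
        by (rule card_Un_disjoint) (use that assms(1) finite_subset[of A B] in auto)
      ultimately show ?thesis by (simp add: power_add)
    qed
    have "{A. A \<in> {A. S \<subseteq> A \<and> A \<subseteq> B} \<and> J \<subseteq> A} = {A. S \<union> J \<subseteq> A \<and> A \<subseteq> B}" by auto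
    then have "(\<Sum>A | A \<in> {A. S \<subseteq> A \<and> A \<subseteq> B} \<and> J \<subseteq> A. (-1) ^ card (A - J) * ?e J) =
        (\<Sum>A | S \<union> J \<subseteq> A \<and> A \<subseteq> B. (-1) ^ card (B - J) * ?e J * (-1) ^ card (B - A))"
      by (intro sum.cong) (auto simp: sgn)
    also have "\<dots> = (-1) ^ card (B - J) * ?e J * (if S \<union> J = B then 1 else 0)"
      using alternating_sum_interval[of B "S \<union> J"] assms J
      by (simp add: sum_distrib_left[symmetric])
    finally show "(\<Sum>A | A \<in> {A. S \<subseteq> A \<and> A \<subseteq> B} \<and> J \<subseteq> A. (-1) ^ card (A - J) * ?e J) =
        (if S \<union> J = B then (-1) ^ card (B - J) * ?e J else 0)" by simp
  qed
  also have "\<dots> = (\<Sum>J | J \<subseteq> B \<and> S \<union> J = B. (-1) ^ card (B - J) * ?e J)"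
    by (rule sum.mono_neutral_cong_right) (use assms in auto)
  also have "\<dots> = (\<Sum>Z\<in>Pow S. (-1) ^ card (S - Z) * ?e ((B - S) \<union> Z))"
  proof (rule sum.reindex_bij_witness[where i = "\<lambda>Z. (B - S) \<union> Z" and j = "\<lambda>J. J \<inter> S"])
    fix J assume "J \<in> {J. J \<subseteq> B \<and> S \<union> J = B}"
    then have J: "(B - S) \<union> (J \<inter> S) = J" "S - J \<inter> S = B - J" by auto
    then show "(B - S) \<union> (J \<inter> S) = J"
      "(-1) ^ card (S - J \<inter> S) * ?e ((B - S) \<union> (J \<inter> S)) = (-1) ^ card (B - J) * ?e J"
      by simp_all
  qed (use assms(2) in auto)
  finally show ?thesis ..
qed

section \<open>Marginal log-linear parameters and collapsibility\<close>

lemma nu_eq_cond_avg: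
  assumes "finite N" "table k N \<noteq> {}" "A \<subseteq> M" "M \<subseteq> N" "x \<in> table k N"
  shows "nu k p A M (restrict x A) = cond_avg k N A (\<lambda>y. ln (pmf (marginal p M) (restrict y M))) x"
  unfolding nu_def by (rule slice_average_eq_cond_avg[OF assms])

lemma mll_eq_effect:
  assumes "finite N" "table k N \<noteq> {}" "A \<subseteq> M" "M \<subseteq> N" "x \<in> table k N"
  shows "mll k p A M (restrict x A) = effect k N A (\<lambda>y. ln (pmf (marginal p M) (restrict y M))) x"
  unfolding mll_def effect_def
proof (rule sum.cong[OF refl])
  fix J assume J: "J \<in> Pow A"
  then have "restrict (restrict x A) J = restrict x J" by (auto simp: fun_eq_iff)
  then show "(-1) ^ card (A - J) * nu k p J M (restrict (restrict x A) J) =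
      (-1) ^ card (A - J) * cond_avg k N J (\<lambda>y. ln (pmf (marginal p M) (restrict y M))) x"
    using nu_eq_cond_avg[OF assms(1,2) _ assms(4,5), of J p] J assms(3) by auto
qed

text \<open>
  Replacing the average \<open>\<nu>\<^sub>M\<^sup>N\<close> in \<open>d\<^sup>(\<^sup>M\<^sup>)\<close> by the logarithm of \<open>p\<^sub>N\<close> does not change a further
  average over a slice given by \<open>Z \<subseteq> M\<close>.
\<close>

lemma dM_avg_eq_cond_avg:
  assumes "finite N" "table k N \<noteq> {}" "Z \<subseteq> M" "M \<subseteq> N" "x \<in> table k N"
  shows "dM_avg k p Z M N (restrict x Z) = cond_avg k N Z
    (\<lambda>y. ln (pmf (marginal p M) (restrict y M)) - ln (pmf (marginal p N) (restrict y N))) x"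
proof -
  let ?g = "\<lambda>y. ln (pmf (marginal p M) (restrict y M))"
  let ?f = "\<lambda>y. ln (pmf (marginal p N) (restrict y N))"
  have "dM_avg k p Z M N (restrict x Z) = cond_avg k N Z (\<lambda>y. dM k p M N (restrict y M)) x"
    unfolding dM_avg_def by (rule slice_average_eq_cond_avg[OF assms])
  also have "\<dots> = cond_avg k N Z (\<lambda>y. ?g y - cond_avg k N M ?f y) x"
    by (rule cond_avg_cong[OF assms(5)])
      (simp add: dM_def nu_eq_cond_avg[OF assms(1,2,4) order_refl])
  also have "\<dots> = cond_avg k N Z ?g x - cond_avg k N (M \<inter> Z) ?f x"
    by (simp add: cond_avg_diff cond_avg_cond_avg[OF assms(1,2)])
  also have "M \<inter> Z = Z" using assms(3) by auto
  finally show ?thesis unfolding cond_avg_diff .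
qed

lemma strictly_collapsible_iff_effect:
  fixes p :: "('v \<Rightarrow> nat) pmf"
  assumes "finite N" "table k N \<noteq> {}" "A \<subseteq> M" "M \<subseteq> N"
  defines "f \<equiv> \<lambda>y. ln (pmf (marginal p N) (restrict y N))"
    and "g \<equiv> \<lambda>y. ln (pmf (marginal p M) (restrict y M))"
  shows "strictly_collapsible k p N M A \<longleftrightarrow>
    (\<forall>x\<in>table k N. effect k N A (\<lambda>y. g y - f y) x = 0) \<and>
    (\<forall>Z. A \<subseteq> Z \<and> Z \<subseteq> N \<and> \<not> Z \<subseteq> M \<longrightarrow> (\<forall>x\<in>table k N. effect k N Z f x = 0))"
proof -
  have AN: "A \<subseteq> N" using assms(3,4) by simp
  have "(\<forall>x\<in>table k A. mll k p A M x = mll k p A N x) \<longleftrightarrow>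
      (\<forall>x\<in>table k N. effect k N A (\<lambda>y. g y - f y) x = 0)"
    unfolding ball_table_iff_ball_restrict[OF assms(2) AN] effect_diff f_def g_def
    using mll_eq_effect[OF assms(1-4)] mll_eq_effect[OF assms(1,2) AN order_refl] by simp
  moreover have "(\<forall>x\<in>table k Z. mll k p Z N x = 0) \<longleftrightarrow> (\<forall>x\<in>table k N. effect k N Z f x = 0)"
    if "Z \<subseteq> N" for Z
    unfolding ball_table_iff_ball_restrict[OF assms(2) that] f_def
    using mll_eq_effect[OF assms(1,2) that order_refl] by simp
  moreover have "Z \<subseteq> N \<and> A \<subset> Z \<and> \<not> Z \<subseteq> M \<longleftrightarrow> A \<subseteq> Z \<and> Z \<subseteq> N \<and> \<not> Z \<subseteq> M" for Z
    using assms(3) by auto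
  ultimately show ?thesis unfolding strictly_collapsible_def by simp
qed

text \<open>
  Passing from \<open>R\<close> to its complement \<open>S - R\<close> turns \<open>L - R\<close> into \<open>(L - S) \<union> (S - R)\<close> and
  changes all signs by the common factor \<open>(-1)\<^bsup>|S|\<^esup>\<close>.
\<close>

lemma alternating_sum_complement:
  fixes e :: "'a set \<Rightarrow> real"
  assumes "finite S" "S \<subseteq> L"
  shows "(\<Sum>R\<in>Pow S. (-1) ^ card (S - R) * e (L - R)) =
    (-1) ^ card S * (\<Sum>Z\<in>Pow S. (-1) ^ card (S - Z) * e ((L - S) \<union> Z))"
  unfolding sum_distrib_left
proof (rule sum.reindex_bij_witness[where i = "\<lambda>Z. S - Z" and j = "\<lambda>R. S - R"])
  fix R assume R: "R \<in> Pow S"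
  then have eqs: "(L - S) \<union> (S - R) = L - R" "S - (S - R) = R" using assms(2) by auto
  have "card S = card R + card (S - R)"
    using R assms(1) by (metis PowD card_Diff_subset card_mono finite_subset le_add_diff_inverse)
  then show "(-1) ^ card S * ((-1) ^ card (S - (S - R)) * e ((L - S) \<union> (S - R))) =
      (-1) ^ card (S - R) * e (L - R)"
    unfolding eqs by (simp add: power_add)
qed auto

theorem theorem3p4:
  fixes V S L M N :: "'v set" and k :: "'v \<Rightarrow> nat" and p :: "('v \<Rightarrow> nat) pmf"
  assumes "finite V"
    and "set_pmf p = table k V"
    and "S \<noteq> {}" and "S \<subseteq> L" and "L \<subseteq> M" and "M \<subset> N" and "N \<subseteq> V"
  shows "(\<forall>A. S \<subseteq> A \<and> A \<subseteq> L \<longrightarrow> strictly_collapsible k p N M A) \<longleftrightarrow>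
    (\<forall>x\<in>table k L.
       (\<Sum>R\<in>Pow S. (-1) ^ card (S - R) * dM_avg k p (L - R) M N (restrict x (L - R))) = 0) \<and>
    (\<forall>x\<in>table k N.
       (\<Sum>Z\<in>Pow S. (-1) ^ card (S - Z) * nu k p ((N - S) \<union> Z) N (restrict x ((N - S) \<union> Z))) =
       (\<Sum>Z\<in>Pow S. (-1) ^ card (S - Z) * nu k p ((M - S) \<union> Z) N (restrict x ((M - S) \<union> Z))))"
proof -
  have finN: "finite N" and MN: "M \<subseteq> N" and SM: "S \<subseteq> M" and SN: "S \<subseteq> N" and LN: "L \<subseteq> N"
    using assms finite_subset[OF assms(7,1)] by auto
  have finM: "finite M" and finL: "finite L" and finS: "finite S"
    using finite_subset[OF _ finN] MN LN SN by blast+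
  have "table k V \<noteq> {}" using assms(2) set_pmf_not_empty by metis
  then have ne: "table k N \<noteq> {}" using assms(7) by (auto simp: table_nonempty_iff)
  define f where "f = (\<lambda>y. ln (pmf (marginal p N) (restrict y N)))"
  define g where "g = (\<lambda>y. ln (pmf (marginal p M) (restrict y M)))"
  let ?h = "\<lambda>y. g y - f y"
  let ?Out = "{Z. S \<subseteq> Z \<and> Z \<subseteq> N \<and> \<not> Z \<subseteq> M}"

  have "(\<forall>A. S \<subseteq> A \<and> A \<subseteq> L \<longrightarrow> strictly_collapsible k p N M A) \<longleftrightarrow>
      (\<forall>A. S \<subseteq> A \<and> A \<subseteq> L \<longrightarrow> (\<forall>x\<in>table k N. effect k N A ?h x = 0) \<and>
        (\<forall>Z. A \<subseteq> Z \<and> Z \<subseteq> N \<and> \<not> Z \<subseteq> M \<longrightarrow> (\<forall>x\<in>table k N. effect k N Z f x = 0)))"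
  proof (intro all_cong1 imp_cong refl)
    fix A assume "S \<subseteq> A \<and> A \<subseteq> L"
    then have "A \<subseteq> M" using assms(5) by blast
    then show "strictly_collapsible k p N M A \<longleftrightarrow> (\<forall>x\<in>table k N. effect k N A ?h x = 0) \<and>
        (\<forall>Z. A \<subseteq> Z \<and> Z \<subseteq> N \<and> \<not> Z \<subseteq> M \<longrightarrow> (\<forall>x\<in>table k N. effect k N Z f x = 0))"
      unfolding f_def g_def by (rule strictly_collapsible_iff_effect[OF finN ne _ MN])
  qed
  \<comment> \<open>The second condition is strongest for \<open>A = S\<close>.\<close>
  also have "\<dots> \<longleftrightarrow> (\<forall>A\<in>{A. S \<subseteq> A \<and> A \<subseteq> L}. \<forall>x\<in>table k N. effect k N A ?h x = 0) \<and>
      (\<forall>Z\<in>?Out. \<forall>x\<in>table k N. effect k N Z f x = 0)"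
    using assms(4) by blast
  finally have collapsible: "(\<forall>A. S \<subseteq> A \<and> A \<subseteq> L \<longrightarrow> strictly_collapsible k p N M A) \<longleftrightarrow> \<dots>" .

  have "(\<forall>x\<in>table k L. (\<Sum>R\<in>Pow S. (-1) ^ card (S - R) *
        dM_avg k p (L - R) M N (restrict x (L - R))) = 0) \<longleftrightarrow>
      (\<forall>x\<in>table k N. (\<Sum>R\<in>Pow S. (-1) ^ card (S - R) *
        dM_avg k p (L - R) M N (restrict (restrict x L) (L - R))) = 0)"
    by (rule ball_table_iff_ball_restrict[OF ne LN])
  also have "\<dots> \<longleftrightarrow> (\<forall>x\<in>table k N. (\<Sum>A | S \<subseteq> A \<and> A \<subseteq> L. effect k N A ?h x) = 0)"
  proof (rule ball_cong[OF refl])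
    fix x assume x: "x \<in> table k N"
    have "dM_avg k p (L - R) M N (restrict (restrict x L) (L - R)) = cond_avg k N (L - R) ?h x" for R
    proof -
      have "L - R \<subseteq> M" "restrict (restrict x L) (L - R) = restrict x (L - R)"
        using assms(5) by (auto simp: fun_eq_iff)
      then show ?thesis using dM_avg_eq_cond_avg[OF finN ne _ MN x] by (simp add: f_def g_def)
    qed
    then have "(\<Sum>R\<in>Pow S. (-1) ^ card (S - R) *
          dM_avg k p (L - R) M N (restrict (restrict x L) (L - R))) =
        (-1) ^ card S * (\<Sum>A | S \<subseteq> A \<and> A \<subseteq> L. effect k N A ?h x)"
      using alternating_sum_complement[OF finS assms(4), of "\<lambda>J. cond_avg k N J ?h x"]
      by (simp only: contrast_eq_sum_effect[OF finL assms(4)])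
    then show "(\<Sum>R\<in>Pow S. (-1) ^ card (S - R) *
          dM_avg k p (L - R) M N (restrict (restrict x L) (L - R))) = 0 \<longleftrightarrow>
        (\<Sum>A | S \<subseteq> A \<and> A \<subseteq> L. effect k N A ?h x) = 0" by simp
  qed
  also have "\<dots> \<longleftrightarrow> (\<forall>A\<in>{A. S \<subseteq> A \<and> A \<subseteq> L}. \<forall>x\<in>table k N. effect k N A ?h x = 0)"
    by (rule sum_effect_zero_iff[OF finN ne]) (use LN in auto)
  finally have first: "(\<forall>x\<in>table k L. (\<Sum>R\<in>Pow S. (-1) ^ card (S - R) *
        dM_avg k p (L - R) M N (restrict x (L - R))) = 0) \<longleftrightarrow> \<dots>" .

  have "(\<forall>x\<in>table k N.
       (\<Sum>Z\<in>Pow S. (-1) ^ card (S - Z) * nu k p ((N - S) \<union> Z) N (restrict x ((N - S) \<union> Z))) =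
       (\<Sum>Z\<in>Pow S. (-1) ^ card (S - Z) * nu k p ((M - S) \<union> Z) N (restrict x ((M - S) \<union> Z)))) \<longleftrightarrow>
     (\<forall>x\<in>table k N. (\<Sum>Z\<in>?Out. effect k N Z f x) = 0)"
  proof (rule ball_cong[OF refl])
    fix x assume x: "x \<in> table k N"
    have contrast: "(\<Sum>Z\<in>Pow S. (-1) ^ card (S - Z) *
          nu k p ((B - S) \<union> Z) N (restrict x ((B - S) \<union> Z))) =
        (\<Sum>A | S \<subseteq> A \<and> A \<subseteq> B. effect k N A f x)" if "S \<subseteq> B" "B \<subseteq> N" for B
    proof -
      have "nu k p ((B - S) \<union> Z) N (restrict x ((B - S) \<union> Z)) = cond_avg k N ((B - S) \<union> Z) f x"
        if "Z \<in> Pow S" for Z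
      proof -
        have "(B - S) \<union> Z \<subseteq> N" using that \<open>B \<subseteq> N\<close> SN by auto
        then show ?thesis unfolding f_def by (rule nu_eq_cond_avg[OF finN ne _ order_refl x])
      qed
      then show ?thesis
        using contrast_eq_sum_effect[OF finite_subset[OF \<open>B \<subseteq> N\<close> finN] \<open>S \<subseteq> B\<close>, of k N f x] by simp
    qed
    have "{A. S \<subseteq> A \<and> A \<subseteq> N} = {A. S \<subseteq> A \<and> A \<subseteq> M} \<union> ?Out" using MN by auto
    moreover have "(\<Sum>A\<in>{A. S \<subseteq> A \<and> A \<subseteq> M} \<union> ?Out. effect k N A f x) =
        (\<Sum>A | S \<subseteq> A \<and> A \<subseteq> M. effect k N A f x) + (\<Sum>Z\<in>?Out. effect k N Z f x)"
      by (rule sum.union_disjoint) (use finM finN in auto)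
    ultimately show "(\<Sum>Z\<in>Pow S. (-1) ^ card (S - Z) *
            nu k p ((N - S) \<union> Z) N (restrict x ((N - S) \<union> Z))) =
          (\<Sum>Z\<in>Pow S. (-1) ^ card (S - Z) *
            nu k p ((M - S) \<union> Z) N (restrict x ((M - S) \<union> Z))) \<longleftrightarrow>
        (\<Sum>Z\<in>?Out. effect k N Z f x) = 0"
      by (simp add: contrast[OF SN order_refl] contrast[OF SM MN])
  qed
  also have "\<dots> \<longleftrightarrow> (\<forall>Z\<in>?Out. \<forall>x\<in>table k N. effect k N Z f x = 0)"
    by (rule sum_effect_zero_iff[OF finN ne]) auto
  finally have second: "(\<forall>x\<in>table k N.
       (\<Sum>Z\<in>Pow S. (-1) ^ card (S - Z) * nu k p ((N - S) \<union> Z) N (restrict x ((N - S) \<union> Z))) =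
       (\<Sum>Z\<in>Pow S. (-1) ^ card (S - Z) * nu k p ((M - S) \<union> Z) N (restrict x ((M - S) \<union> Z)))) \<longleftrightarrow> \<dots>" .

  show ?thesis unfolding collapsible first second ..
qed

end
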